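(* Let $n$ be a nonnegative integer, let $\alpha,\beta\in\mathbb{C}$ and put $\lambda=\alpha+\beta+1$. Assume $\alpha\notin\{-1,-2,\dots,-n\}$ and $\lambda\notin\{0,-1,\dots,-2n\}$, so that no denominator below vanishes. Then the following connection formula for Hermite polynomials in series of shifted Jacobi polynomials holds: $$H_n(x)=\sum_{m=0}^{n}\frac{(-n)_m\,4^n\,(2m+\lambda)\,(\alpha+1)_n}{(\alpha+1)_m\,(\lambda+m)_{n+1}}\;{}_{4}F_{2}\!\left(\begin{array}{c}\Delta(2,m-n),\ \Delta(2,-\lambda-n-m)\\ \Delta(2,-\alpha-n)\end{array}\Bigg|\,\frac14\right)P_{m}^{(\alpha,\beta)}(1-x),$$ where $\Delta(r,\varphi)$ stands for the $r$ parameters $\frac{\varphi+j-1}{r}$, $j=1,\dots,r$; thus $\Delta(2,\varphi)$ stands for the two parameters $\frac{\varphi}{2},\frac{\varphi+1}{2}$.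
   Context: $(a)_0=1$ and $(a)_k=a(a+1)\cdots(a+k-1)$ denote the Pochhammer symbol. The generalized hypergeometric function is $${}_pF_q\!\left(\begin{array}{c}a_1,\dots,a_p\\ b_1,\dots,b_q\end{array}\Bigg|\,z\right)=\sum_{t\ge 0}\frac{(a_1)_t\cdots(a_p)_t}{(b_1)_t\cdots(b_q)_t}\frac{z^t}{t!}.$$ In the claim one of the upper parameters is the nonpositive integer $-\lfloor (n-m)/2\rfloor$, so the series terminates and is taken over $0\le t\le\lfloor (n-m)/2\rfloor$. The Hermite polynomials are $$H_n(x)=n!\sum_{k=0}^{\lfloor n/2\rfloor}\frac{(-1)^k}{k!\,(n-2k)!}(2x)^{n-2k}.$$ $P_m^{(\alpha,\beta)}$ is the Jacobi polynomial, so that $$P_m^{(\alpha,\beta)}(1-x)=\frac{(\alpha+1)_m}{m!}\sum_{s=0}^{m}\frac{(-m)_s\,(m+\alpha+\beta+1)_s}{(\alpha+1)_s\,s!}\left(\frac{x}{2}\right)^s.$$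
   Formalization: The argument of the 4F2 is -1/4 instead of the printed 1/4; with 1/4 the formula fails already for n=2, where the right-hand side equals 4x^2+2 while H_2(x)=4x^2-2. *)

theory Defs
  imports Complex_Main
begin

text \<open>
  If an upper parameter is \<open>-N\<close> for a natural number \<open>N\<close>, all terms with \<open>t > N\<close> have numerator
  zero, so they vanish also where a lower parameter makes their denominator zero
  (as \<open>0 / 0 = 0\<close>); see \<open>hypergeometric_terminates\<close>.
\<close>

definition hypergeometric :: "complex list \<Rightarrow> complex list \<Rightarrow> complex \<Rightarrow> complex" where
  "hypergeometric as bs z =
     (\<Sum>t. (\<Prod>a\<leftarrow>as. pochhammer a t) / (\<Prod>b\<leftarrow>bs. pochhammer b t) * (z ^ t / fact t))"

definition Delta :: "nat \<Rightarrow> complex \<Rightarrow> complex list" where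
  "Delta r \<phi> = map (\<lambda>j. (\<phi> + of_nat j - 1) / of_nat r) [1..<Suc r]"

definition hermite :: "nat \<Rightarrow> complex \<Rightarrow> complex" where
  "hermite n x =
     fact n * (\<Sum>k\<le>n div 2. (-1) ^ k / (fact k * fact (n - 2 * k)) * (2 * x) ^ (n - 2 * k))"

text \<open>
  This agrees with the Jacobi polynomial unless \<open>\<alpha> \<in> {-1, \<dots>, -m}\<close>, where the factor
  \<open>(\<alpha> + 1)\<^sub>m / (\<alpha> + 1)\<^sub>s\<close> would have to be cancelled first.
\<close>

definition jacobi :: "nat \<Rightarrow> complex \<Rightarrow> complex \<Rightarrow> complex \<Rightarrow> complex" where
  "jacobi m \<alpha> \<beta> y =
     pochhammer (\<alpha> + 1) m / fact m *
     (\<Sum>s\<le>m. pochhammer (- of_nat m) s * pochhammer (of_nat m + \<alpha> + \<beta> + 1) s /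
             (pochhammer (\<alpha> + 1) s * fact s) * ((1 - y) / 2) ^ s)"

lemma Delta_2: "Delta 2 \<phi> = [\<phi> / 2, (\<phi> + 1) / 2]"
  by (simp add: Delta_def numeral_2_eq_2)

lemma hypergeometric_terminates:
  assumes "- of_nat N \<in> set as"
  shows "hypergeometric as bs z =
    (\<Sum>t\<le>N. (\<Prod>a\<leftarrow>as. pochhammer a t) / (\<Prod>b\<leftarrow>bs. pochhammer b t) * (z ^ t / fact t))"
  unfolding hypergeometric_def
proof (rule suminf_finite)
  fix t assume "t \<notin> {..N}"
  then have "pochhammer (- of_nat N :: complex) t = 0"
    by (simp add: pochhammer_of_nat_eq_0_iff)
  then have "(0::complex) \<in> set (map (\<lambda>a. pochhammer a t) as)"
    using assms by (metis image_eqI set_map)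
  then have "(\<Prod>a\<leftarrow>as. pochhammer a t) = 0"
    by (simp add: prod_list_zero_iff)
  then show "(\<Prod>a\<leftarrow>as. pochhammer a t) / (\<Prod>b\<leftarrow>bs. pochhammer b t) * (z ^ t / fact t) = 0"
    by simp
qed simp

text \<open>
  The connection formula is also found printed with hypergeometric argument \<open>1/4\<close>. That is a sign
  error: with \<open>H\<^sub>n\<close> as defined above the argument is \<open>-1/4\<close>, since the term
  \<open>(-1)\<^sup>k\<close> of \<open>H\<^sub>n\<close> contributes \<open>(-1)\<^sup>k 16\<^sup>-\<^sup>k 4\<^sup>k = (-1/4)\<^sup>k\<close>. The version with
  \<open>1/4\<close> already fails for \<open>n = 2\<close> and \<open>\<alpha> = \<beta> = 0\<close>, \<open>lam = 1\<close>.
\<close>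

lemma connection_formula_fails_at_positive_quarter:
  "\<not> (\<forall>n \<alpha> \<beta> lam x. lam = \<alpha> + \<beta> + 1 \<longrightarrow>
        \<alpha> \<notin> (\<lambda>k. - of_nat k) ` {1..n} \<longrightarrow>
        lam \<notin> (\<lambda>k. - of_nat k) ` {0..2 * n} \<longrightarrow>
        hermite n x =
          (\<Sum>m\<le>n.
             pochhammer (- of_nat n) m * 4 ^ n * (2 * of_nat m + lam) * pochhammer (\<alpha> + 1) n /
             (pochhammer (\<alpha> + 1) m * pochhammer (lam + of_nat m) (n + 1)) *
             hypergeometric
               (Delta 2 (of_nat m - of_nat n) @ Delta 2 (- lam - of_nat n - of_nat m))
               (Delta 2 (- \<alpha> - of_nat n))
               (1 / 4) *
             jacobi m \<alpha> \<beta> (1 - x)))" (is "\<not> ?claim")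
proof
  assume claim: ?claim
  have c0: "(0::complex) \<notin> (\<lambda>k. - of_nat k) ` {1..2::nat}" by auto
  have c1: "(1::complex) \<notin> (\<lambda>k. - of_nat k) ` {0..2 * 2::nat}"
  proof
    assume "(1::complex) \<in> (\<lambda>k. - of_nat k) ` {0..2 * 2::nat}"
    then obtain k :: nat where "(1::complex) = - of_nat k" by blast
    then have "Re 1 = Re (- of_nat k)" by (rule arg_cong)
    then show False by simp
  qed
  have *: "hermite 2 0 =
      (\<Sum>m\<le>2.
         pochhammer (- of_nat 2) m * 4 ^ 2 * (2 * of_nat m + 1) * pochhammer (0 + 1) 2 /
         (pochhammer (0 + 1) m * pochhammer (1 + of_nat m) (2 + 1)) *
         hypergeometric
           (Delta 2 (of_nat m - of_nat 2) @ Delta 2 (- 1 - of_nat 2 - of_nat m))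
           (Delta 2 (- 0 - of_nat 2))
           (1 / 4) *
         jacobi m 0 0 (1 - 0))"
    using claim[rule_format, where n = 2 and \<alpha> = 0 and \<beta> = 0 and lam = 1 and x = 0] c0 c1
    by (simp only: add_0_left refl simp_thms)
  have h0: "hypergeometric [-1, -(1/2), -(3/2), -1] [-1, -(1/2)] (1/4) = 11/8"
    by (subst hypergeometric_terminates[where N = 1]) (simp_all add: pochhammer_Suc)
  have one: "(\<Prod>a\<leftarrow>as. 1) = (1::complex)" for as :: "complex list"
    by (induction as) simp_all
  have h1: "hypergeometric (-(1/2) # 0 # as) bs z = 1" for as bs z
    by (subst hypergeometric_terminates[where N = 0]) (simp_all add: one)
  have h2: "hypergeometric (0 # as) bs z = 1" for as bs z
    by (subst hypergeometric_terminates[where N = 0]) (simp_all add: one)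
  have j: "jacobi m 0 0 1 = 1" for m
    by (simp add: jacobi_def pochhammer_fact[symmetric] sum.atMost_shift)
  show False
    using *[unfolded Delta_2]
    by (simp add: hermite_def numeral_2_eq_2 sum.atMost_Suc pochhammer_Suc h0 h1 h2 j)
qed

end

theory Submission
  imports Defs
begin

text \<open>
  Inverting the definition of the Jacobi polynomials expresses each monomial as
  \<open>x\<^sup>N = 2\<^sup>N (\<alpha>+1)\<^sub>N \<Sum>\<^sub>m (-N)\<^sub>m (2m+\<lambda>) / ((\<alpha>+1)\<^sub>m (\<lambda>+m)\<^bsub>N+1\<^esub>) P\<^sub>m(1-x)\<close>.
  The orthogonality relation behind this inversion has a hypergeometric term with a closed-form
  antidifference, so it telescopes. Substituting into the Hermite sum and exchanging the order of
  summation, the coefficient of \<open>P\<^sub>m\<close> is the terminating series, because reversing a Pochhammer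
  symbol turns \<open>(a)\<^bsub>n-2k\<^esub>\<close> into \<open>(a)\<^sub>n / (1-a-n)\<^bsub>2k\<^esub>\<close>, and duplication splits each
  \<open>(\<phi>)\<^bsub>2k\<^esub>\<close> into the two parameters \<open>\<Delta>(2,\<phi>)\<close>.
\<close>

section \<open>Pochhammer symbols: negative integers and reversal\<close>

lemma pochhammer_neg_of_nat_mult_fact:
  fixes m N :: nat
  assumes "m \<le> N"
  shows "pochhammer (- of_nat N :: complex) m * fact (N - m) = (-1) ^ m * fact N"
proof -
  have "pochhammer 1 N = pochhammer 1 (N - m) * pochhammer (1 + of_nat (N - m) :: complex) m"
    using pochhammer_product[of "N - m" N "1::complex"] assms by simp
  then show ?thesis
    using assms by (simp add: pochhammer_fact pochhammer_minus of_nat_diff algebra_simps)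
qed

text \<open>The last \<open>2 * k\<close> factors of \<open>pochhammer a n\<close>, negated and read
  backwards, start at \<open>1 - a - of_nat n\<close>; their number is even, so the signs
  cancel.\<close>

lemma pochhammer_split_reversed_even:
  fixes a :: complex
  assumes "2 * k \<le> n"
  shows "pochhammer a n = pochhammer a (n - 2 * k) * pochhammer (1 - a - of_nat n) (2 * k)"
proof -
  have "pochhammer (1 - a - of_nat n) (2 * k) = pochhammer (a + of_nat (n - 2 * k)) (2 * k)"
    using pochhammer_minus[of "a + of_nat n - 1" "2 * k"] assms
    by (simp add: of_nat_diff algebra_simps)
  then show ?thesis
    using pochhammer_product[of "n - 2 * k" n a] assms by simp
qed

section \<open>Inversion of the Jacobi polynomials: telescoping, orthogonality, monomials\<close>

lemma pochhammer_nonzero: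
  fixes a :: complex
  assumes "\<And>i. i < n \<Longrightarrow> a + of_nat i \<noteq> 0"
  shows "pochhammer a n \<noteq> 0"
  using assms by (auto simp: pochhammer_eq_0_iff add_eq_0_iff2)

text \<open>The right-hand side is an antidifference of the summand. It contains
  \<open>p choose J\<close>, hence is zero at \<open>J = Suc p\<close>, where the sum is
  complete.\<close>

lemma alternating_binomial_sum_telescopes:
  fixes \<mu> :: complex
  assumes "\<And>i. i \<le> J + Suc p \<Longrightarrow> \<mu> + of_nat i \<noteq> 0"
  shows "(\<Sum>j\<le>J. (-1) ^ j * of_nat (Suc p choose j) * (2 * of_nat j + \<mu>) /
            pochhammer (\<mu> + of_nat j) (Suc (Suc p)))
       = (-1) ^ J * of_nat (p choose J) / pochhammer (\<mu> + of_nat J + 1) (Suc p)"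
  using assms
proof (induction J)
  case 0
  have "\<mu> \<noteq> 0" using 0[of 0] by simp
  then show ?case by (simp add: pochhammer_rec[of \<mu> "Suc p"])
next
  case (Suc J)
  define \<nu> where "\<nu> = \<mu> + of_nat (Suc J)"
  define P where "P = pochhammer (\<nu> + 1) p"
  define A B :: complex where "A = of_nat (p choose J)" and "B = of_nat (p choose Suc J)"
  have "\<mu> + of_nat (Suc J + i) \<noteq> 0" if "i \<le> Suc p" for i
    using Suc.prems[of "Suc J + i"] that by auto
  then have nz: "\<nu> + of_nat i \<noteq> 0" if "i \<le> Suc p" for i
    using that by (simp add: \<nu>_def add.assoc)
  have \<nu>0: "\<nu> \<noteq> 0" and \<nu>1: "\<nu> + of_nat p + 1 \<noteq> 0"
    using nz[of 0] nz[of "Suc p"] by (simp_all add: algebra_simps)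
  have P0: "P \<noteq> 0"
    unfolding P_def
  proof (rule pochhammer_nonzero)
    fix i assume "i < p"
    then show "\<nu> + 1 + of_nat i \<noteq> 0" using nz[of "Suc i"] by (simp add: algebra_simps)
  qed
  \<comment> \<open>The three denominators share \<open>P\<close>: \<open>p1\<close> is that of the
    induction hypothesis, \<open>p2\<close> that of the goal, \<open>p3\<close> that of the new
    term.\<close>
  have p1: "pochhammer \<nu> (Suc p) = \<nu> * P"
    by (simp add: P_def pochhammer_rec)
  have p2: "pochhammer (\<nu> + 1) (Suc p) = P * (\<nu> + of_nat p + 1)"
    by (simp add: P_def pochhammer_Suc algebra_simps)
  have p3: "pochhammer \<nu> (Suc (Suc p)) = \<nu> * P * (\<nu> + of_nat p + 1)"
    by (simp only: pochhammer_rec[of \<nu> "Suc p"] p2) (simp add: algebra_simps)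
  have "Suc J * (p choose Suc J) = (p - J) * (p choose J)"
    by (simp only: binomial_absorption binomial_absorb_comp)
  then have "of_nat (Suc J * (p choose Suc J)) = (of_nat ((p - J) * (p choose J)) :: complex)"
    by (rule arg_cong)
  \<comment> \<open>For \<open>J > p\<close> the truncated subtraction differs from the complex one,
    but there both binomials are zero.\<close>
  then have AB: "(of_nat J + 1) * B = (of_nat p - of_nat J) * A"
    by (cases "J \<le> p") (auto simp: A_def B_def of_nat_diff binomial_eq_0 algebra_simps)
  have "(\<Sum>j\<le>Suc J. (-1) ^ j * of_nat (Suc p choose j) * (2 * of_nat j + \<mu>) /
            pochhammer (\<mu> + of_nat j) (Suc (Suc p)))
      = (-1) ^ J * A / (\<nu> * P) -
        (-1) ^ J * (A + B) * (\<nu> + of_nat J + 1) / (\<nu> * P * (\<nu> + of_nat p + 1))"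
  proof -
    have "(\<Sum>j\<le>J. (-1) ^ j * of_nat (Suc p choose j) * (2 * of_nat j + \<mu>) /
            pochhammer (\<mu> + of_nat j) (Suc (Suc p))) = (-1) ^ J * A / pochhammer \<nu> (Suc p)"
      using Suc by (simp add: A_def \<nu>_def add_ac)
    moreover have "2 * of_nat (Suc J) + \<mu> = \<nu> + of_nat J + 1"
      by (simp add: \<nu>_def)
    ultimately show ?thesis
      unfolding sum.atMost_Suc \<nu>_def[symmetric] p3 p1 by (simp add: A_def B_def)
  qed
  also have "\<dots> = (-1) ^ J * (A * (\<nu> + of_nat p + 1) - (A + B) * (\<nu> + of_nat J + 1)) /
      (\<nu> * P * (\<nu> + of_nat p + 1))"
    using \<nu>0 \<nu>1 P0 by (simp add: divide_simps) (simp add: algebra_simps)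
  \<comment> \<open>The factor \<open>A + B\<close> came from Pascal's rule. Expansion leaves
    \<open>A * (p - J) - B * (\<nu> + J + 1)\<close>, and \<open>AB\<close> turns the first product
    into \<open>(J + 1) * B\<close>.\<close>
  also have "A * (\<nu> + of_nat p + 1) - (A + B) * (\<nu> + of_nat J + 1) = - B * \<nu>"
    using AB by (simp add: algebra_simps)
  also have "(-1) ^ J * (- B * \<nu>) / (\<nu> * P * (\<nu> + of_nat p + 1))
      = (-1) ^ Suc J * B / (P * (\<nu> + of_nat p + 1))"
    using \<nu>0 by simp
  finally show ?case unfolding p2[symmetric] unfolding B_def \<nu>_def .
qed

lemma alternating_binomial_sum_eq_delta:
  fixes \<mu> :: complex
  assumes "\<And>i. i \<le> 2 * M \<Longrightarrow> \<mu> + of_nat i \<noteq> 0"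
  shows "(\<Sum>j\<le>M. (-1) ^ j * of_nat (M choose j) * (2 * of_nat j + \<mu>) /
            pochhammer (\<mu> + of_nat j) (Suc M)) = (if M = 0 then 1 else 0)"
proof (cases M)
  case 0
  then show ?thesis using assms[of 0] by simp
next
  case (Suc p)
  then show ?thesis
    using alternating_binomial_sum_telescopes[of "Suc p" p \<mu>] assms by simp
qed

text \<open>Terms with \<open>m < s\<close> vanish. For \<open>m = s + j\<close>, the factor
  \<open>pochhammer (of_nat m + lam) s\<close> cancels the first \<open>s\<close> factors of the
  denominator, leaving the alternating binomial sum with \<open>M = N - s\<close> and
  \<open>\<mu> = lam + 2 * s\<close>.\<close>

lemma jacobi_orthogonality_sum:
  fixes lam :: complex
  assumes "s \<le> N" and "\<And>i. i \<le> 2 * N \<Longrightarrow> lam + of_nat i \<noteq> 0"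
  shows "(\<Sum>m\<le>N. pochhammer (- of_nat N) m * pochhammer (- of_nat m) s *
             (2 * of_nat m + lam) * pochhammer (of_nat m + lam) s /
             (fact m * pochhammer (lam + of_nat m) (Suc N)))
         = (if s = N then fact N else 0)"
    (is "(\<Sum>m\<le>N. ?f m) = _")
proof -
  define M where "M = N - s"
  have N: "N = s + M" using assms by (simp add: M_def)
  have term_eq: "?f (s + j) = fact N / fact M * ((-1) ^ j * of_nat (M choose j) *
      (2 * of_nat j + (lam + of_nat (2 * s))) /
      pochhammer (lam + of_nat (2 * s) + of_nat j) (Suc M))" if "j \<le> M" for j
  proof -
    have p1: "pochhammer (- of_nat N :: complex) (s + j) = (-1) ^ (s + j) * fact N / fact (M - j)"
      using pochhammer_neg_of_nat_mult_fact[of "s + j" N] that by (simp add: N field_simps)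
    have p2: "pochhammer (- of_nat (s + j) :: complex) s = (-1) ^ s * fact (s + j) / fact j"
      using pochhammer_neg_of_nat_mult_fact[of s "s + j"] by (simp add: field_simps)
    have p3: "pochhammer (lam + of_nat (s + j)) (Suc N) =
        pochhammer (of_nat (s + j) + lam) s * pochhammer (lam + of_nat (2 * s) + of_nat j) (Suc M)"
      using pochhammer_product[of s "Suc N" "lam + of_nat (s + j)"]
      by (simp add: N Suc_diff_le algebra_simps)
    define Q where "Q = pochhammer (of_nat (s + j) + lam) s"
    define R where "R = pochhammer (lam + of_nat (2 * s) + of_nat j) (Suc M)"
    define F :: complex where "F = fact (s + j)"
    define E where "E = 2 * of_nat j + (lam + of_nat (2 * s))"
    have Q0: "Q \<noteq> 0"
      unfolding Q_def
    proof (rule pochhammer_nonzero)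
      fix i assume "i < s"
      then show "of_nat (s + j) + lam + of_nat i \<noteq> 0"
        using assms(2)[of "s + j + i"] that by (simp add: N algebra_simps)
    qed
    have F0: "F \<noteq> 0" by (simp add: F_def)
    have bin: "of_nat (M choose j) = (fact M / (fact j * fact (M - j)) :: complex)"
      using that by (rule binomial_fact)
    have sgn: "(-1) ^ j = ((-1) ^ (s + j) * (-1) ^ s :: complex)"
      by (simp add: power_add flip: power_mult_distrib)
    have E: "2 * of_nat (s + j) + lam = E"
      by (simp add: E_def)
    show ?thesis
      unfolding p1 p2 p3 bin sgn E E_def[symmetric] Q_def[symmetric] R_def[symmetric]
        F_def[symmetric]
      using Q0 F0 by (simp add: divide_simps)
  qed
  have "(\<Sum>m\<le>N. ?f m) = (\<Sum>m\<in>{s..N}. ?f m)"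
    by (rule sum.mono_neutral_right) (auto simp: pochhammer_of_nat_eq_0_iff)
  also have "\<dots> = (\<Sum>j\<le>M. ?f (s + j))"
    by (rule sum.reindex_bij_witness[of _ "\<lambda>j. s + j" "\<lambda>m. m - s"]) (auto simp: N)
  also have "\<dots> = fact N / fact M * (\<Sum>j\<le>M. (-1) ^ j * of_nat (M choose j) *
      (2 * of_nat j + (lam + of_nat (2 * s))) /
      pochhammer (lam + of_nat (2 * s) + of_nat j) (Suc M))"
    unfolding sum_distrib_left by (rule sum.cong) (use term_eq in auto)
  also have "\<dots> = fact N / fact M * (if M = 0 then 1 else 0)"
  proof (subst alternating_binomial_sum_eq_delta)
    fix i assume "i \<le> 2 * M"
    then show "lam + of_nat (2 * s) + of_nat i \<noteq> 0"
      using assms(2)[of "2 * s + i"] by (simp add: N add.assoc)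
  qed (rule refl)
  finally show ?thesis by (simp add: N)
qed

text \<open>Expand each Jacobi polynomial in powers of \<open>x / 2\<close> and exchange the sums:
  by orthogonality only the power \<open>s = N\<close> survives.\<close>

lemma power_eq_sum_jacobi:
  fixes \<alpha> \<beta> lam x :: complex
  assumes lam: "lam = \<alpha> + \<beta> + 1"
    and \<alpha>: "\<And>i. i < N \<Longrightarrow> \<alpha> + 1 + of_nat i \<noteq> 0"
    and lam0: "\<And>i. i \<le> 2 * N \<Longrightarrow> lam + of_nat i \<noteq> 0"
  shows "x ^ N = 2 ^ N * pochhammer (\<alpha> + 1) N *
    (\<Sum>m\<le>N. pochhammer (- of_nat N) m * (2 * of_nat m + lam) /
       (pochhammer (\<alpha> + 1) m * pochhammer (lam + of_nat m) (Suc N)) * jacobi m \<alpha> \<beta> (1 - x))"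
    (is "_ = _ * (\<Sum>m\<le>N. ?c m * _)")
proof -
  define w where "w = x / 2"
  define g where "g m s = pochhammer (- of_nat N) m * pochhammer (- of_nat m) s *
             (2 * of_nat m + lam) * pochhammer (of_nat m + lam) s /
             (fact m * pochhammer (lam + of_nat m) (Suc N))" for m s
  have nz: "pochhammer (\<alpha> + 1) m \<noteq> 0" if "m \<le> N" for m
    by (rule pochhammer_nonzero) (use \<alpha> that in auto)
  have "?c m * jacobi m \<alpha> \<beta> (1 - x) = (\<Sum>s\<le>N. g m s * (w ^ s / (pochhammer (\<alpha> + 1) s * fact s)))"
    if "m \<le> N" for m
  proof -
    have "jacobi m \<alpha> \<beta> (1 - x) = pochhammer (\<alpha> + 1) m / fact m *
       (\<Sum>s\<le>m. pochhammer (- of_nat m) s * pochhammer (of_nat m + lam) s /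
             (pochhammer (\<alpha> + 1) s * fact s) * w ^ s)"
      by (simp add: jacobi_def lam w_def add.assoc)
    \<comment> \<open>Extending the range by zero terms makes it independent of \<open>m\<close>, so
      that the sums can be exchanged.\<close>
    also have "(\<Sum>s\<le>m. pochhammer (- of_nat m) s * pochhammer (of_nat m + lam) s /
             (pochhammer (\<alpha> + 1) s * fact s) * w ^ s) =
        (\<Sum>s\<le>N. pochhammer (- of_nat m) s * pochhammer (of_nat m + lam) s /
             (pochhammer (\<alpha> + 1) s * fact s) * w ^ s)"
      using that by (intro sum.mono_neutral_left) (auto simp: pochhammer_of_nat_eq_0_iff)
    finally show ?thesis
      using nz[OF that]
      by (simp add: sum_distrib_left g_def mult_ac)
  qed
  then have "(\<Sum>m\<le>N. ?c m * jacobi m \<alpha> \<beta> (1 - x)) =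
      (\<Sum>m\<le>N. \<Sum>s\<le>N. g m s * (w ^ s / (pochhammer (\<alpha> + 1) s * fact s)))"
    by simp
  also have "\<dots> = (\<Sum>s\<le>N. (\<Sum>m\<le>N. g m s) * (w ^ s / (pochhammer (\<alpha> + 1) s * fact s)))"
    unfolding sum_distrib_right by (rule sum.swap)
  also have "\<dots> = (\<Sum>s\<le>N. (if s = N then fact N else 0) * (w ^ s / (pochhammer (\<alpha> + 1) s * fact s)))"
    by (rule sum.cong) (auto simp: g_def jacobi_orthogonality_sum lam0)
  also have "\<dots> = (\<Sum>s\<le>N. if s = N then w ^ N / pochhammer (\<alpha> + 1) N else 0)"
    by (rule sum.cong) auto
  also have "\<dots> = w ^ N / pochhammer (\<alpha> + 1) N"
    by simp
  finally show ?thesis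
    using nz[of N] by (simp add: w_def power_divide)
qed

section \<open>The terminating series and its match with the Hermite coefficients\<close>

lemma pochhammer_halves:
  fixes a :: complex
  shows "pochhammer (a / 2) t * pochhammer ((a + 1) / 2) t = pochhammer a (2 * t) / 4 ^ t"
  using pochhammer_double[of "a / 2" t]
  by (simp add: power_mult add_divide_distrib)

text \<open>Each pair \<open>Delta 2\<close> yields a factor \<open>1 / 4 ^ t\<close>; two pairs
  above and one below leave a single one, absorbed into \<open>z / 4\<close>. Termination is phrased
  through \<open>pochhammer a (2 * t)\<close> because the parity of an integer \<open>a\<close>
  decides which half-parameter stops the series.\<close>

lemma hypergeometric_Delta_2_terminating:
  fixes a b c z :: complex
  assumes "\<And>t. t > K \<Longrightarrow> pochhammer a (2 * t) = 0"
  shows "hypergeometric (Delta 2 a @ Delta 2 b) (Delta 2 c) z =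
    (\<Sum>t\<le>K. pochhammer a (2 * t) * pochhammer b (2 * t) / pochhammer c (2 * t) *
       (z / 4) ^ t / fact t)"
proof -
  have *: "(\<Prod>a\<leftarrow>Delta 2 a @ Delta 2 b. pochhammer a t) / (\<Prod>b\<leftarrow>Delta 2 c. pochhammer b t) *
      (z ^ t / fact t) = pochhammer a (2 * t) * pochhammer b (2 * t) / pochhammer c (2 * t) *
       (z / 4) ^ t / fact t" for t
    by (simp add: Delta_2 mult.assoc[symmetric] pochhammer_halves)
       (simp add: mult.assoc pochhammer_halves power_divide)
  show ?thesis
    unfolding hypergeometric_def *
    by (rule suminf_finite) (use assms in auto)
qed

text \<open>Up to factors independent of \<open>m\<close> or of \<open>k\<close>, the left side is
  the contribution of the \<open>k\<close>-th Hermite term to the \<open>m\<close>-th Jacobi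
  coefficient. Reversal turns every symbol of length governed by \<open>n - 2 * k\<close> into one
  governed by \<open>n\<close>.\<close>

lemma connection_coefficient:
  fixes \<alpha> lam :: complex
  assumes "m \<le> n" "2 * k \<le> n"
    and \<alpha>: "\<And>i. i < n \<Longrightarrow> \<alpha> + 1 + of_nat i \<noteq> 0"
    and lam0: "\<And>i. i \<le> 2 * n \<Longrightarrow> lam + of_nat i \<noteq> 0"
  shows "fact n / fact (n - 2 * k) * pochhammer (\<alpha> + 1) (n - 2 * k) *
      pochhammer (- of_nat (n - 2 * k)) m / pochhammer (lam + of_nat m) (Suc (n - 2 * k)) =
    pochhammer (- of_nat n) m * pochhammer (\<alpha> + 1) n / pochhammer (lam + of_nat m) (Suc n) *
      (pochhammer (of_nat m - of_nat n) (2 * k) * pochhammer (- lam - of_nat n - of_nat m) (2 * k) /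
       pochhammer (- \<alpha> - of_nat n) (2 * k))"
proof (cases "m \<le> n - 2 * k")
  \<comment> \<open>Here \<open>m > n - 2 * k\<close>, and both sides vanish.\<close>
  case False
  then have "pochhammer (- of_nat (n - 2 * k) :: complex) m = 0"
    by (simp add: pochhammer_of_nat_eq_0_iff)
  moreover have "pochhammer (of_nat m - of_nat n :: complex) (2 * k) = 0"
  proof -
    have "pochhammer (- of_nat (n - m) :: complex) (2 * k) = 0"
      using False assms by (subst pochhammer_of_nat_eq_0_iff) linarith
    then show ?thesis using assms by (simp add: of_nat_diff)
  qed
  ultimately show ?thesis by simp
next
  case True
  define N where "N = n - 2 * k"
  have mN: "m \<le> N" using True by (simp add: N_def)
  have \<alpha>n: "pochhammer (\<alpha> + 1) n \<noteq> 0"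
    by (rule pochhammer_nonzero) (use \<alpha> in auto)
  have lamn: "pochhammer (lam + of_nat m) (Suc n) \<noteq> 0"
  proof (rule pochhammer_nonzero)
    fix i assume "i < Suc n"
    then show "lam + of_nat m + of_nat i \<noteq> 0"
      using lam0[of "m + i"] assms(1) by (simp add: add.assoc)
  qed
  define a where "a = pochhammer (- \<alpha> - of_nat n) (2 * k)"
  define l where "l = pochhammer (- lam - of_nat n - of_nat m) (2 * k)"
  define d :: complex where "d = pochhammer (of_nat m - of_nat n) (2 * k)"
  have a: "pochhammer (\<alpha> + 1) n = pochhammer (\<alpha> + 1) N * a"
    using pochhammer_split_reversed_even[OF assms(2), of "\<alpha> + 1"] by (simp add: N_def a_def)
  have l: "pochhammer (lam + of_nat m) (Suc n) = pochhammer (lam + of_nat m) (Suc N) * l"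
    using pochhammer_split_reversed_even[of k "Suc n" "lam + of_nat m"] assms(2)
    by (simp add: N_def l_def Suc_diff_le algebra_simps)
  \<comment> \<open>Reversal with base \<open>1\<close>, as \<open>fact (n - m)\<close> is
    \<open>pochhammer 1 (n - m)\<close>; the reversed tail starts at \<open>m - n\<close>.\<close>
  have d: "fact (n - m) = fact (N - m) * d"
    using pochhammer_split_reversed_even[of k "n - m" 1] assms mN
    by (simp add: N_def d_def pochhammer_fact of_nat_diff add.commute diff_diff_left)
  have mN': "pochhammer (- of_nat N :: complex) m = (-1) ^ m * fact N / fact (N - m)"
    using pochhammer_neg_of_nat_mult_fact[OF mN] by (simp add: field_simps)
  have mn': "pochhammer (- of_nat n :: complex) m = (-1) ^ m * fact n / (fact (N - m) * d)"
    using pochhammer_neg_of_nat_mult_fact[OF assms(1)] unfolding d[symmetric]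
    by (simp add: field_simps)
  have "a \<noteq> 0" "l \<noteq> 0" using \<alpha>n lamn by (auto simp: a l)
  moreover have "d \<noteq> 0" using fact_nonzero[of "n - m", where 'a = complex] d by auto
  ultimately show ?thesis
    unfolding N_def[symmetric] a_def[symmetric] l_def[symmetric] d_def[symmetric] a l mN' mn'
    by simp
qed

section \<open>Substitution into the Hermite sum and exchange of summation\<close>

theorem theorem3p3:
  fixes n :: nat and \<alpha> \<beta> lam x :: complex
  assumes "lam = \<alpha> + \<beta> + 1"
    and "\<alpha> \<notin> (\<lambda>k. - of_nat k) ` {1..n}"
    and "lam \<notin> (\<lambda>k. - of_nat k) ` {0..2 * n}"
  shows "hermite n x =
    (\<Sum>m\<le>n.
       pochhammer (- of_nat n) m * 4 ^ n * (2 * of_nat m + lam) * pochhammer (\<alpha> + 1) n /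
       (pochhammer (\<alpha> + 1) m * pochhammer (lam + of_nat m) (n + 1)) *
       hypergeometric
         (Delta 2 (of_nat m - of_nat n) @ Delta 2 (- lam - of_nat n - of_nat m))
         (Delta 2 (- \<alpha> - of_nat n))
         (- 1 / 4) *
       jacobi m \<alpha> \<beta> (1 - x))"
proof -
  have \<alpha>: "\<alpha> + 1 + of_nat i \<noteq> 0" if "i < n" for i
  proof
    assume "\<alpha> + 1 + of_nat i = 0"
    then have "\<alpha> + of_nat (Suc i) = 0" by (simp add: add_ac)
    then have "\<alpha> = - of_nat (Suc i)" by (simp only: eq_neg_iff_add_eq_0)
    then show False using assms(2) that by (auto simp del: of_nat_Suc)
  qed
  have lam0: "lam + of_nat i \<noteq> 0" if "i \<le> 2 * n" for i
    using assms(3) that by (auto simp: add_eq_0_iff2)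
  \<comment> \<open>\<open>J\<close> and \<open>C\<close> collect what depends on \<open>m\<close>
    only; \<open>R m k\<close> is the parameter quotient of the series term of index
    \<open>k\<close>.\<close>
  define J where "J m = jacobi m \<alpha> \<beta> (1 - x) * (2 * of_nat m + lam) / pochhammer (\<alpha> + 1) m" for m
  define C where "C m = pochhammer (- of_nat n) m * pochhammer (\<alpha> + 1) n /
    pochhammer (lam + of_nat m) (Suc n)" for m
  define R where "R m k = pochhammer (of_nat m - of_nat n) (2 * k) *
    pochhammer (- lam - of_nat n - of_nat m) (2 * k) / pochhammer (- \<alpha> - of_nat n) (2 * k)" for m k
  have pow: "fact n * ((-1) ^ k / (fact k * fact (n - 2 * k)) * (2 * x) ^ (n - 2 * k)) =
      (\<Sum>m\<le>n. 4 ^ n * (- 1 / 16) ^ k / fact k * (C m * R m k * J m))"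
    if "k \<le> n div 2" for k
  proof -
    define N where "N = n - 2 * k"
    have k: "2 * k \<le> n" using that by simp
    have "x ^ N = 2 ^ N * pochhammer (\<alpha> + 1) N *
      (\<Sum>m\<le>N. pochhammer (- of_nat N) m * (2 * of_nat m + lam) /
       (pochhammer (\<alpha> + 1) m * pochhammer (lam + of_nat m) (Suc N)) * jacobi m \<alpha> \<beta> (1 - x))"
      using assms(1) \<alpha> lam0 by (intro power_eq_sum_jacobi) (auto simp: N_def)
    also have "(\<Sum>m\<le>N. pochhammer (- of_nat N) m * (2 * of_nat m + lam) /
       (pochhammer (\<alpha> + 1) m * pochhammer (lam + of_nat m) (Suc N)) * jacobi m \<alpha> \<beta> (1 - x)) =
       (\<Sum>m\<le>n. pochhammer (- of_nat N) m / pochhammer (lam + of_nat m) (Suc N) * J m)"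
      by (rule sum.mono_neutral_cong_left)
         (auto simp: J_def N_def pochhammer_of_nat_eq_0_iff mult_ac)
    finally have xN: "x ^ N = 2 ^ N * pochhammer (\<alpha> + 1) N *
       (\<Sum>m\<le>n. pochhammer (- of_nat N) m / pochhammer (lam + of_nat m) (Suc N) * J m)" .
    \<comment> \<open>One \<open>2 ^ N\<close> comes from \<open>(2 * x) ^ N\<close>, the other from
      the expansion of \<open>x ^ N\<close>. The resulting \<open>- 1 / 16\<close> is
      \<open>z / 4\<close> at \<open>z = - 1 / 4\<close>.\<close>
    have sgn: "(-1) ^ k * 4 ^ N = (4 ^ n * (- 1 / 16) ^ k :: complex)"
    proof -
      have "(4::complex) ^ n = 4 ^ N * 16 ^ k"
        using k power_add[of "4::complex" N "2 * k"] by (simp add: N_def power_mult)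
      moreover have "16 ^ k * (- 1 / 16) ^ k = ((-1) ^ k :: complex)"
        by (simp flip: power_mult_distrib)
      ultimately show ?thesis by (simp only: mult_ac)
    qed
    have "fact n * ((-1) ^ k / (fact k * fact N) * (2 * x) ^ N) =
      ((-1) ^ k * 4 ^ N) / fact k * (\<Sum>m\<le>n. fact n / fact N * pochhammer (\<alpha> + 1) N *
        pochhammer (- of_nat N) m / pochhammer (lam + of_nat m) (Suc N) * J m)"
      by (simp add: power_mult_distrib xN sum_distrib_left mult_ac flip: power_mult_distrib)
    also have "(\<Sum>m\<le>n. fact n / fact N * pochhammer (\<alpha> + 1) N *
        pochhammer (- of_nat N) m / pochhammer (lam + of_nat m) (Suc N) * J m) =
        (\<Sum>m\<le>n. C m * R m k * J m)"
    proof (rule sum.cong)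
      fix m assume "m \<in> {..n}"
      then have "m \<le> n" by simp
      from connection_coefficient[OF this k \<alpha> lam0]
      show "fact n / fact N * pochhammer (\<alpha> + 1) N *
        pochhammer (- of_nat N) m / pochhammer (lam + of_nat m) (Suc N) * J m = C m * R m k * J m"
        by (simp only: N_def C_def R_def)
    qed simp
    finally show ?thesis
      unfolding sgn sum_distrib_left unfolding N_def .
  qed
  \<comment> \<open>The bound \<open>n div 2\<close> serves all \<open>m\<close> at once, matching
    the Hermite sum; terms beyond \<open>(n - m) div 2\<close> are zero.\<close>
  have hyp: "hypergeometric
         (Delta 2 (of_nat m - of_nat n) @ Delta 2 (- lam - of_nat n - of_nat m))
         (Delta 2 (- \<alpha> - of_nat n)) (- 1 / 4) =
      (\<Sum>k\<le>n div 2. R m k * (- 1 / 16) ^ k / fact k)" if "m \<le> n" for m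
  proof (subst hypergeometric_Delta_2_terminating[where K = "n div 2"])
    fix t assume "n div 2 < t"
    then have "n - m < 2 * t" by linarith
    then have "pochhammer (- of_nat (n - m) :: complex) (2 * t) = 0"
      by (simp only: pochhammer_of_nat_eq_0_iff)
    then show "pochhammer (of_nat m - of_nat n :: complex) (2 * t) = 0"
      using that by (simp add: of_nat_diff)
  qed (simp add: R_def)
  have "hermite n x = (\<Sum>k\<le>n div 2. \<Sum>m\<le>n. 4 ^ n * (- 1 / 16) ^ k / fact k * (C m * R m k * J m))"
    unfolding hermite_def sum_distrib_left by (rule sum.cong) (use pow in auto)
  also have "\<dots> = (\<Sum>m\<le>n. 4 ^ n * C m * J m * (\<Sum>k\<le>n div 2. R m k * (- 1 / 16) ^ k / fact k))"
    by (subst sum.swap) (simp add: sum_distrib_left mult_ac)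
  also have "\<dots> = (\<Sum>m\<le>n.
       pochhammer (- of_nat n) m * 4 ^ n * (2 * of_nat m + lam) * pochhammer (\<alpha> + 1) n /
       (pochhammer (\<alpha> + 1) m * pochhammer (lam + of_nat m) (n + 1)) *
       hypergeometric
         (Delta 2 (of_nat m - of_nat n) @ Delta 2 (- lam - of_nat n - of_nat m))
         (Delta 2 (- \<alpha> - of_nat n)) (- 1 / 4) *
       jacobi m \<alpha> \<beta> (1 - x))"
    by (rule sum.cong[OF refl]) (simp only: atMost_iff hyp C_def J_def, simp add: mult_ac)
  finally show ?thesis .
qed

end
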